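(* Suppose the inverse robust optimization problem $(\mathcal{P}_{\mathrm{IROP}})$ has a maximizer $(x^*,W^* )\in X\times\mathcal{W}$, and suppose that either $h(x^*,\cdot):=\max\{f(x^*,\cdot),g(x^*,\cdot)\}$ is a coercive function of $u$, or $\mathcal{U}$ is bounded. Then the set $W^*$ is bounded.
   Context: Here $X\subseteq\mathbb{R}^n$, $\mathcal{U}\subseteq\mathbb{R}^m$ is the uncertainty set, $\mathcal{W}\subseteq 2^{\mathcal{U}}$ is the cover space, $V:\mathcal{W}\to\mathbb{R}$ is the merit function, and $f,g$ are real-valued functions of $(x,u)$ with $x\in X$, $u\in\mathbb{R}^m$, such that $f(\cdot,u)$ and $g(\cdot,u)$ are continuous on $X$ for each fixed $u$. A nominal scenario $\bar u\in\mathcal{U}$ is fixed, and it is assumed that the nominal problem $f^*:=\min\{f(x,\bar u): x\in X,\ g(x,\bar u)\le 0\}$ has a feasible point and that $f^*$ is well defined. A budget $\epsilon\ge 0$ is fixed. The inverse robust optimization problem $(\mathcal{P}_{\mathrm{IROP}})$ is: maximize $V(W)$ over all $(x,W)\in X\times\mathcal{W}$ subject to $f(x,u)\le f^*+\epsilon$ for all $u\in W$, $\ g(x,u)\le 0$ for all $u\in W$, and $\bar u\in W$. A maximizer is a feasible pair attaining the maximal value of $V(W)$ among feasible pairs. Coercivity of $h(x^*,\cdot)$ means $\lim_{n\to\infty}h(x^*,u_n)=\infty$ for every sequence $(u_n)_{n\in\mathbb{N}}\subseteq\mathcal{U}$ with $\|u_n\|\to\infty$. *)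

theory Defs
  imports "HOL-Analysis.Analysis"
begin

definition nominal_feasible ::
  "('a \<Rightarrow> 'b \<Rightarrow> real) \<Rightarrow> 'a set \<Rightarrow> 'b \<Rightarrow> 'a set"
  where "nominal_feasible g X ubar = {x \<in> X. g x ubar \<le> 0}"

text \<open>The minimum itself, not an infimum; it is meaningful only if a minimizer exists.\<close>

definition nominal_value ::
  "('a \<Rightarrow> 'b \<Rightarrow> real) \<Rightarrow> ('a \<Rightarrow> 'b \<Rightarrow> real) \<Rightarrow> 'a set \<Rightarrow> 'b \<Rightarrow> real"
  where "nominal_value f g X ubar =
    (LEAST y. y \<in> (\<lambda>x. f x ubar) ` nominal_feasible g X ubar)"

definition nominal_value_well_defined ::
  "('a \<Rightarrow> 'b \<Rightarrow> real) \<Rightarrow> ('a \<Rightarrow> 'b \<Rightarrow> real) \<Rightarrow> 'a set \<Rightarrow> 'b \<Rightarrow> bool"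
  where "nominal_value_well_defined f g X ubar \<longleftrightarrow>
    (\<exists>x. is_arg_min (\<lambda>x. f x ubar) (\<lambda>x. x \<in> nominal_feasible g X ubar) x)"

definition irop_feasible ::
  "('a \<Rightarrow> 'b \<Rightarrow> real) \<Rightarrow> ('a \<Rightarrow> 'b \<Rightarrow> real) \<Rightarrow> 'a set \<Rightarrow> 'b set set \<Rightarrow> 'b \<Rightarrow> real
    \<Rightarrow> 'a \<times> 'b set \<Rightarrow> bool"
  where "irop_feasible f g X \<W> ubar \<epsilon> = (\<lambda>(x, W).
    x \<in> X \<and> W \<in> \<W> \<and>
    (\<forall>u\<in>W. f x u \<le> nominal_value f g X ubar + \<epsilon>) \<and>
    (\<forall>u\<in>W. g x u \<le> 0) \<and>
    ubar \<in> W)"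

definition irop_maximizer ::
  "('b set \<Rightarrow> real) \<Rightarrow> ('a \<Rightarrow> 'b \<Rightarrow> real) \<Rightarrow> ('a \<Rightarrow> 'b \<Rightarrow> real) \<Rightarrow> 'a set \<Rightarrow> 'b set set
    \<Rightarrow> 'b \<Rightarrow> real \<Rightarrow> 'a \<times> 'b set \<Rightarrow> bool"
  where "irop_maximizer V f g X \<W> ubar \<epsilon> =
    is_arg_max (\<lambda>(x, W). V W) (irop_feasible f g X \<W> ubar \<epsilon>)"

definition coercive_on :: "'b::real_normed_vector set \<Rightarrow> ('b \<Rightarrow> real) \<Rightarrow> bool"
  where "coercive_on \<U> h \<longleftrightarrow>
    (\<forall>u :: nat \<Rightarrow> 'b. (\<forall>n. u n \<in> \<U>) \<longrightarrow>
      filterlim (\<lambda>n. norm (u n)) at_top sequentially \<longrightarrow>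
      filterlim (\<lambda>n. h (u n)) at_top sequentially)"

end

theory Submission
  imports Defs
begin

text \<open>Sublevel sets of a coercive function are bounded: an unbounded one would contain a
  sequence whose norms tend to infinity while the function stays below a fixed level along it
  (\<open>coercive_on_bounded_sublevel\<close>). The constraints on a feasible pair cap both
  \<open>f xstar\<close> and \<open>g xstar\<close> on \<open>Wstar\<close>, which places
  \<open>Wstar\<close> inside a sublevel set of their pointwise maximum. If instead \<U> is bounded,
  so is its subset \<open>Wstar\<close>.\<close>

lemma coercive_on_bounded_sublevel:
  assumes coercive: "coercive_on \<U> h"
    and sub: "W \<subseteq> \<U>"
    and le: "\<And>u. u \<in> W \<Longrightarrow> h u \<le> c"
  shows "bounded W"
proof (rule ccontr)
  assume "\<not> bounded W"
  \<comment> \<open>Each natural number fails as a norm bound for \<open>W\<close>; choosing a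
    witness for each gives the escaping sequence.\<close>
  then have "\<forall>n. \<exists>u\<in>W. real n < norm u"
    by (meson bounded_iff not_le)
  then obtain u where u: "\<And>n. u n \<in> W" "\<And>n. real n < norm (u n)"
    by metis
  have "filterlim (\<lambda>n. norm (u n)) at_top sequentially"
    by (rule filterlim_at_top_mono[OF filterlim_real_sequentially])
      (simp add: u(2) less_imp_le)
  then have "filterlim (\<lambda>n. h (u n)) at_top sequentially"
    using coercive sub u(1) unfolding coercive_on_def by blast
  \<comment> \<open>Divergence lifts \<open>h\<close> above \<open>c\<close> at some term of the
    sequence, yet every term lies in \<open>W\<close>.\<close>
  then have "\<forall>\<^sub>F n in sequentially. c < h (u n)"
    by (simp add: filterlim_at_top_dense)
  then show False
    using le u(1) by (auto simp: eventually_sequentially not_less[symmetric])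
qed

theorem lemma2p7:
  fixes X :: "(real ^ 'n) set"
    and \<U> :: "(real ^ 'm) set"
    and \<W> :: "(real ^ 'm) set set"
    and V :: "(real ^ 'm) set \<Rightarrow> real"
    and f g :: "real ^ 'n \<Rightarrow> real ^ 'm \<Rightarrow> real"
    and ubar :: "real ^ 'm"
    and \<epsilon> :: real
    and xstar :: "real ^ 'n"
    and Wstar :: "(real ^ 'm) set"
  assumes "\<W> \<subseteq> Pow \<U>"
    and "\<And>u. continuous_on X (\<lambda>x. f x u)"
    and "\<And>u. continuous_on X (\<lambda>x. g x u)"
    and "ubar \<in> \<U>"
    and "nominal_feasible g X ubar \<noteq> {}"
    and "nominal_value_well_defined f g X ubar"
    and "\<epsilon> \<ge> 0"
    and "irop_maximizer V f g X \<W> ubar \<epsilon> (xstar, Wstar)"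
    and "coercive_on \<U> (\<lambda>u. max (f xstar u) (g xstar u)) \<or> bounded \<U>"
  shows "bounded Wstar"
proof -
  have feasible: "irop_feasible f g X \<W> ubar \<epsilon> (xstar, Wstar)"
    using assms(8) by (simp add: irop_maximizer_def is_arg_max_def)
  then have sub: "Wstar \<subseteq> \<U>"
    using assms(1) by (auto simp: irop_feasible_def)
  \<comment> \<open>The level joins the two constraint bounds: the budgeted nominal value for
    \<open>f\<close> and 0 for \<open>g\<close>. The outer maximum is taken because the budgeted
    value may be negative.\<close>
  have le: "max (f xstar u) (g xstar u) \<le> max (nominal_value f g X ubar + \<epsilon>) 0"
    if "u \<in> Wstar" for u
    using feasible that by (intro max.mono) (auto simp: irop_feasible_def)
  from assms(9) show ?thesis
  proof
    assume "coercive_on \<U> (\<lambda>u. max (f xstar u) (g xstar u))"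
    then show ?thesis
      using sub le by (rule coercive_on_bounded_sublevel)
  next
    assume "bounded \<U>"
    then show ?thesis
      using sub by (rule bounded_subset)
  qed
qed

end
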